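(* Let $\Delta\subseteq S^3$ be a spherical tetrahedron with vertices $v_0,v_1,v_2,v_3$. Let $\{i,j,k,m\}=\{0,1,2,3\}$, let $l=l_{ij}$ be the length of the edge $v_iv_j$, let $\theta=\theta_{ij}$ be the interior dihedral angle of $\Delta$ at the edge $v_iv_j$, and let $l'=l_{km}$ be the length of the opposite edge $v_kv_m$. Regard $l'$ as a function of the six interior dihedral angles $(\theta_{01},\theta_{02},\theta_{03},\theta_{12},\theta_{13},\theta_{23})$. Then the partial derivative of $l'$ with respect to $\theta$, the other five dihedral angles being held fixed, is $$\frac{\partial l'}{\partial \theta}=\frac{\sin l\,\sin l'}{\sqrt{\det G}},$$ where $G$ is the $4\times 4$ length Gram matrix $G_{pq}=\cos(l_{pq})$ of $\Delta$.
   Context: Given linearly independent unit vectors $v_0,v_1,v_2,v_3\in S^3\subset\mathbb{R}^4$, the spherical tetrahedron with these vertices is $\Delta=\{t_0v_0+t_1v_1+t_2v_2+t_3v_3 : t_0,\dots,t_3\ge 0\}\cap S^3$. The edge length $l_{pq}=l(v_p,v_q)\in(0,\pi)$ is the spherical distance between $v_p$ and $v_q$, i.e. $\cos l_{pq}=v_p\cdot v_q$ (with $l_{pp}=0$, so $G_{pp}=1$). The interior dihedral angle $\theta_{ij}\in(0,\pi)$ at the edge $v_iv_j$ is the angle with $\cos\theta_{ij}=-w_k\cdot w_m$, where $\{i,j,k,m\}=\{0,1,2,3\}$ and, for each $p$, $w_p\in\mathbb{R}^4$ is the outward unit normal to the face of $\Delta$ opposite $v_p$ (so $w_p\cdot v_q=0$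 for $q\neq p$ and $w_p\cdot v_p<0$). A spherical tetrahedron is determined up to isometry by its six edge lengths, and also by its six interior dihedral angles, so there is a one-to-one correspondence between the 6-tuples of edge lengths and the 6-tuples of interior dihedral angles of spherical tetrahedra. It is via this correspondence that an edge length is regarded as a function of the six dihedral angles. *)

theory Defs
  imports "HOL-Analysis.Analysis"
begin

text \<open>The vertex labels 0, 1, 2, 3 are the elements of the type \<^typ>\<open>4\<close>. A spherical tetrahedron
  is given by its labelled vertices; \<open>inj v\<close> is needed because \<open>independent\<close> speaks about
  the set of vertices, not about the family.\<close>

definition spherical_tetrahedron :: "(4 \<Rightarrow> real^4) \<Rightarrow> bool" where
  "spherical_tetrahedron v \<longleftrightarrow> (\<forall>p. v p \<in> sphere 0 1) \<and> inj v \<and> independent (range v)"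

definition edge_length :: "(4 \<Rightarrow> real^4) \<Rightarrow> 4 \<Rightarrow> 4 \<Rightarrow> real" where
  "edge_length v p q = arccos (v p \<bullet> v q)"

definition length_Gram :: "(4 \<Rightarrow> real^4) \<Rightarrow> real^4^4" where
  "length_Gram v = (\<chi> p q. cos (edge_length v p q))"

definition outward_normal :: "(4 \<Rightarrow> real^4) \<Rightarrow> 4 \<Rightarrow> real^4" where
  "outward_normal v p = (THE w. norm w = 1 \<and> (\<forall>q. q \<noteq> p \<longrightarrow> w \<bullet> v q = 0) \<and> w \<bullet> v p < 0)"

text \<open>The edge joining the vertices \<open>i\<close> and \<open>j\<close> is represented by the two-element set \<open>{i, j}\<close>,
  so that a 6-tuple indexed by the edges is a function on sets of labels of which only the
  values at two-element sets matter.\<close>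

definition dihedral_angle :: "(4 \<Rightarrow> real^4) \<Rightarrow> 4 set \<Rightarrow> real" where
  "dihedral_angle v e = (THE \<theta>. 0 < \<theta> \<and> \<theta> < pi \<and>
     (\<forall>k m. - e = {k, m} \<longrightarrow> cos \<theta> = - (outward_normal v k \<bullet> outward_normal v m)))"

text \<open>The edge length between \<open>p\<close> and \<open>q\<close> as a function of the six dihedral angles: the common
  value for all spherical tetrahedra with these dihedral angles.\<close>

definition length_of_angles :: "(4 set \<Rightarrow> real) \<Rightarrow> 4 \<Rightarrow> 4 \<Rightarrow> real" where
  "length_of_angles \<Theta> p q = (THE l. \<exists>u. spherical_tetrahedron u \<and>
     (\<forall>e. card e = 2 \<longrightarrow> dihedral_angle u e = \<Theta> e) \<and> l = edge_length u p q)"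

end

theory Submission
  imports Defs
begin

text \<open>Let \<open>w p\<close> be the outward normals, and write \<open>\<theta>\<close> for the angle at the edge \<open>{i, j}\<close> and \<open>l\<close>, \<open>l'\<close>
  for the lengths of the edges \<open>{i, j}\<close> and \<open>{k, m}\<close>. The dihedral angles are the same data as the
  Gram matrix of the normals, and \<open>\<theta>\<close> enters through \<open>w k \<bullet> w m = - cos \<theta>\<close> only. Project \<open>w k\<close>
  and \<open>w m\<close> orthogonally to the plane of \<open>v k\<close> and \<open>v m\<close>, which is the complement of the span of \<open>w i\<close>
  and \<open>w j\<close>. The projections are perpendicular to \<open>v m\<close> and \<open>v k\<close>, so they enclose the angle
  \<open>pi - l'\<close>. Their lengths depend only on the five other angles, and their inner product is
  \<open>K - cos \<theta>\<close> with \<open>K\<close> depending only on the five other angles. Hence \<open>cos l' = (cos \<theta> - K) / R\<close>,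
  where \<open>R\<close> is the product of the two lengths (\<open>perp_inner_normals\<close>, \<open>edge_length_from_angles\<close>).

  This formula shows that \<open>l'\<close> is determined by the angles. That it may be differentiated in
  \<open>\<theta>\<close> also needs a tetrahedron for every nearby value of \<open>\<theta>\<close>. The polar family of four independent
  unit vectors is a spherical tetrahedron having these vectors as its outward normals, so it
  suffices to move the single normal \<open>w m\<close> (\<open>eventually_exists_tetrahedron_with_angles\<close>).

  Differentiation gives \<open>sin \<theta> / (R sin l')\<close>. With \<open>x = (w k \<bullet> v k) (w m \<bullet> v m)\<close> one has
  \<open>R = x / sin\<^sup>2 l'\<close>, and expressing the volume spanned by the vertices through the edge \<open>{i, j}\<close> and
  the two normals gives \<open>sqrt (det G) sin \<theta> = x sin l\<close> (\<open>det_length_Gram\<close>). Together these turn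
  the derivative into \<open>sin l sin l' / sqrt (det G)\<close>.\<close>

section \<open>Polar duality of spherical tetrahedra\<close>

text \<open>Vertices and outward unit normals play symmetric roles here. This symmetry is what allows a
  tetrahedron to be produced from a prescribed family of normals.\<close>

definition polar :: "(4 \<Rightarrow> real^4) \<Rightarrow> (4 \<Rightarrow> real^4) \<Rightarrow> bool" where
  "polar v w \<longleftrightarrow> (\<forall>p. norm (v p) = 1 \<and> norm (w p) = 1 \<and> w p \<bullet> v p < 0) \<and>
     (\<forall>p q. p \<noteq> q \<longrightarrow> w p \<bullet> v q = 0)"

lemma polar_sym: "polar v w \<Longrightarrow> polar w v"
  unfolding polar_def by (metis inner_commute)

lemma polar_inner_self:
  assumes "polar v w" shows "v p \<bullet> v p = 1" "w p \<bullet> w p = 1"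
  using assms by (auto simp: polar_def dot_square_norm)

text \<open>The dual family certifies independence: \<open>w p\<close> kills every vertex but \<open>v p\<close>, so \<open>v p\<close> is not a
  combination of the others.\<close>

lemma polar_imp_spherical_tetrahedron:
  assumes "polar v w" shows "spherical_tetrahedron v"
proof -
  have "inj v"
    by (rule injI) (metis assms order_less_irrefl polar_def)
  moreover have "v p \<notin> span (range v - {v p})" for p
  proof
    assume "v p \<in> span (range v - {v p})"
    then have "orthogonal (w p) (v p)"
      by (rule orthogonal_to_span) (use assms in \<open>auto simp: polar_def orthogonal_def, metis\<close>)
    then show False
      using assms by (auto simp: polar_def orthogonal_def dest: spec[of _ p])
  qed
  then have "independent (range v)"
    by (auto simp: dependent_def)
  ultimately show ?thesis
    using assms by (auto simp: spherical_tetrahedron_def polar_def)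
qed

lemma spherical_tetrahedron_orthogonal_imp_zero:
  assumes "spherical_tetrahedron v" and "\<And>p. z \<bullet> v p = 0"
  shows "z = 0"
proof -
  have "card (range v) = 4" "independent (range v)"
    using assms(1) by (auto simp: spherical_tetrahedron_def card_image)
  then have "span (range v) = UNIV"
    by (simp add: dim_eq_full[symmetric] dim_eq_card_independent)
  then have "orthogonal z z"
    using orthogonal_to_span[of z "range v" z] assms(2) by (auto simp: orthogonal_def)
  then show ?thesis by (simp add: orthogonal_def)
qed

text \<open>The three vertices other than \<open>v p\<close> span a proper subspace, so some vector is orthogonal to all
  of them. It cannot be orthogonal to \<open>v p\<close> as well because the vertices span the whole space, so
  after scaling, with a sign, it is the outward normal.\<close>

lemma spherical_tetrahedron_imp_polar:
  assumes "spherical_tetrahedron v" shows "\<exists>w. polar v w"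
proof -
  have "\<exists>w. norm w = 1 \<and> w \<bullet> v p < 0 \<and> (\<forall>q. p \<noteq> q \<longrightarrow> w \<bullet> v q = 0)" for p
  proof -
    have "dim (v ` (- {p})) \<le> card (v ` (- {p}))"
      by (intro dim_le_card') simp
    also have "\<dots> \<le> card (- {p})"
      by (intro card_image_le) simp
    also have "\<dots> = 3"
      by (simp add: Compl_eq_Diff_UNIV card_Diff_singleton)
    finally obtain x where x: "x \<noteq> 0" "\<And>y. y \<in> span (v ` (- {p})) \<Longrightarrow> orthogonal x y"
      using orthogonal_to_subspace_exists[of "v ` (- {p})"] by auto
    have x0: "x \<bullet> v q = 0" if "p \<noteq> q" for q
      using x(2)[of "v q"] that by (auto simp: orthogonal_def span_base)
    have "x \<bullet> v p \<noteq> 0"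
      using spherical_tetrahedron_orthogonal_imp_zero[OF assms, of x] x0 x(1) by metis
    then show ?thesis
      using x(1) x0
      by (intro exI[of _ "(- sgn (x \<bullet> v p) / norm x) *\<^sub>R x"])
         (auto simp: sgn_real_def divide_simps)
  qed
  then have "\<exists>w. \<forall>p. norm (w p) = 1 \<and> w p \<bullet> v p < 0 \<and> (\<forall>q. p \<noteq> q \<longrightarrow> w p \<bullet> v q = 0)"
    by metis
  then show ?thesis
    using assms by (auto simp: polar_def spherical_tetrahedron_def)
qed

text \<open>Up to scaling, the normals are the dual basis of the vertices; both sides have the same inner
  product with every vertex.\<close>

lemma polar_expansion:
  assumes "polar v w"
  shows "z = (\<Sum>p\<in>UNIV. (z \<bullet> v p / (w p \<bullet> v p)) *\<^sub>R w p)"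
proof -
  let ?s = "\<Sum>p\<in>UNIV. (z \<bullet> v p / (w p \<bullet> v p)) *\<^sub>R w p"
  have "(z - ?s) \<bullet> v q = 0" for q
  proof -
    have ortho: "w p \<bullet> v q = 0" if "p \<noteq> q" for p
      using assms that unfolding polar_def by metis
    have nz: "w q \<bullet> v q \<noteq> 0"
      using assms unfolding polar_def by (metis less_irrefl)
    have "?s \<bullet> v q = (\<Sum>p\<in>UNIV. (z \<bullet> v p / (w p \<bullet> v p)) * (w p \<bullet> v q))"
      by (simp add: inner_sum_left)
    also have "\<dots> = (\<Sum>p\<in>UNIV. if p = q then z \<bullet> v q else 0)"
      using ortho nz by (intro sum.cong) auto
    finally show ?thesis by (simp add: inner_diff_left)
  qed
  then have "z - ?s = 0"
    by (rule spherical_tetrahedron_orthogonal_imp_zero[OF polar_imp_spherical_tetrahedron[OF assms]])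
  then show ?thesis by simp
qed

text \<open>A vector orthogonal to all vertices but \<open>v p\<close> has only one term in its expansion in normals, so
  it is a multiple of \<open>w p\<close>; unit length and the sign condition fix the factor.\<close>

lemma polar_outward_normal:
  assumes "polar v w" shows "outward_normal v = w"
proof
  fix p
  show "outward_normal v p = w p"
    unfolding outward_normal_def
  proof (rule the_equality)
    show "norm (w p) = 1 \<and> (\<forall>q. q \<noteq> p \<longrightarrow> w p \<bullet> v q = 0) \<and> w p \<bullet> v p < 0"
      using assms by (auto simp: polar_def)
  next
    fix x assume x: "norm x = 1 \<and> (\<forall>q. q \<noteq> p \<longrightarrow> x \<bullet> v q = 0) \<and> x \<bullet> v p < 0"
    let ?c = "x \<bullet> v p / (w p \<bullet> v p)"
    have "x = (\<Sum>q\<in>UNIV. (x \<bullet> v q / (w q \<bullet> v q)) *\<^sub>R w q)"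
      by (rule polar_expansion[OF assms])
    also have "\<dots> = (\<Sum>q\<in>UNIV. if q = p then ?c *\<^sub>R w p else 0)"
      using x by (intro sum.cong) auto
    finally have xc: "x = ?c *\<^sub>R w p" by simp
    have "?c > 0"
      using x assms by (simp add: polar_def divide_neg_neg)
    moreover have "\<bar>?c\<bar> = 1"
      using arg_cong[OF xc, of norm] x assms by (simp only: norm_scaleR polar_def mult_1_right)
    ultimately have "?c = 1" by linarith
    then show "x = w p" using xc by simp
  qed
qed

text \<open>Removing from \<open>v p\<close> its component along \<open>v q\<close> leaves a vector that still pairs with \<open>w p\<close>
  as \<open>v p\<close> does, hence a nonzero one.\<close>

lemma polar_inner_less_1:
  assumes "polar v w" "p \<noteq> q" shows "\<bar>v p \<bullet> v q\<bar> < 1"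
proof -
  let ?z = "v p - (v p \<bullet> v q) *\<^sub>R v q"
  have "?z \<bullet> w p = w p \<bullet> v p" "w p \<bullet> v p \<noteq> 0"
    using assms by (auto simp: polar_def inner_diff_right inner_commute[of _ "w p"] dest: spec[of _ p])
  then have "?z \<noteq> 0" by force
  then have "?z \<bullet> ?z > 0" by simp
  also have "?z \<bullet> ?z = 1 - (v p \<bullet> v q)\<^sup>2"
    using polar_inner_self[OF assms(1)]
    by (simp add: inner_diff_left inner_diff_right inner_commute power2_eq_square)
  finally show ?thesis by (simp add: abs_square_less_1)
qed

section \<open>Edge lengths and dihedral angles as inner products\<close>

lemma cos_edge_length:
  assumes "polar v w" shows "cos (edge_length v p q) = v p \<bullet> v q"
proof -
  have "\<bar>v p \<bullet> v q\<bar> \<le> 1"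
    using Cauchy_Schwarz_ineq2[of "v p" "v q"] assms by (simp add: polar_def)
  then show ?thesis by (simp add: edge_length_def cos_arccos_abs)
qed

lemma sin_edge_length:
  assumes "polar v w" "p \<noteq> q" 
  shows "sin (edge_length v p q) > 0" "(sin (edge_length v p q))\<^sup>2 = 1 - (v p \<bullet> v q)\<^sup>2"
proof -
  have "\<bar>v p \<bullet> v q\<bar> < 1" by (rule polar_inner_less_1[OF assms])
  then have "0 < arccos (v p \<bullet> v q)" "arccos (v p \<bullet> v q) < pi"
    using arccos_lt_bounded[of "v p \<bullet> v q"] by linarith+
  then show "sin (edge_length v p q) > 0"
    by (simp add: edge_length_def sin_gt_zero)
  show "(sin (edge_length v p q))\<^sup>2 = 1 - (v p \<bullet> v q)\<^sup>2"
    by (simp add: sin_squared_eq cos_edge_length[OF assms(1)])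
qed

lemma labels_distinct:
  fixes i j k m :: 4
  assumes "{i, j, k, m} = UNIV" shows "distinct [i, j, k, m]"
  using assms card_distinct[of "[i, j, k, m]"] by simp

lemma dihedral_angle_eqI:
  assumes "polar v w" and e: "- e = {k, m}"
    and \<theta>: "0 < \<theta>" "\<theta> < pi" "cos \<theta> = - (w k \<bullet> w m)"
  shows "dihedral_angle v e = \<theta>"
proof -
  have sym: "w p \<bullet> w q = w k \<bullet> w m" if "- e = {p, q}" for p q
  proof -
    have "p = k \<and> q = m \<or> p = m \<and> q = k"
      using that[unfolded e] by (simp only: doubleton_eq_iff) (elim disjE; simp)
    then show ?thesis by (elim disjE conjE) (simp_all only: inner_commute)
  qed
  have "(\<forall>p q. - e = {p, q} \<longrightarrow> cos \<phi> = - (w p \<bullet> w q)) \<longleftrightarrow> cos \<phi> = - (w k \<bullet> w m)" for \<phi>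
    using sym e by metis
  then have "dihedral_angle v e = (THE \<phi>. 0 < \<phi> \<and> \<phi> < pi \<and> cos \<phi> = cos \<theta>)"
    by (simp only: dihedral_angle_def polar_outward_normal[OF assms(1)] \<theta>(3))
  also have "\<dots> = \<theta>"
    using \<theta>(1,2) by (intro the_equality) (auto intro: cos_inj_pi)
  finally show ?thesis .
qed

lemma dihedral_angle:
  assumes "polar v w" "- e = {k, m}" "k \<noteq> m"
  shows "0 < dihedral_angle v e" "dihedral_angle v e < pi"
    and "cos (dihedral_angle v e) = - (w k \<bullet> w m)"
proof -
  have c: "\<bar>w k \<bullet> w m\<bar> < 1"
    by (rule polar_inner_less_1[OF polar_sym[OF assms(1)] assms(3)])
  then have a: "0 < arccos (- (w k \<bullet> w m))" "arccos (- (w k \<bullet> w m)) < pi"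
    "cos (arccos (- (w k \<bullet> w m))) = - (w k \<bullet> w m)"
    using arccos_lt_bounded[of "- (w k \<bullet> w m)"] by (auto simp: cos_arccos_abs)
  have eq: "dihedral_angle v e = arccos (- (w k \<bullet> w m))"
    by (rule dihedral_angle_eqI[OF assms(1,2) a])
  show "0 < dihedral_angle v e" "dihedral_angle v e < pi"
    and "cos (dihedral_angle v e) = - (w k \<bullet> w m)"
    unfolding eq by (rule a)+
qed

section \<open>Projecting two normals to the plane of the opposite edge\<close>

text \<open>The inner product of the components of \<open>x\<close> and \<open>y\<close> orthogonal to two unit vectors \<open>e\<close> and \<open>f\<close>,
  computed from inner products alone: \<open>g = e \<bullet> f\<close>, \<open>a\<close> and \<open>b\<close> are the products of \<open>x\<close> with \<open>e\<close> and
  \<open>f\<close>, \<open>a'\<close> and \<open>b'\<close> those of \<open>y\<close>, and \<open>h = x \<bullet> y\<close>. It is an entry of a Schur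
  complement in the Gram matrix of \<open>e\<close>, \<open>f\<close>, \<open>x\<close>, \<open>y\<close>.\<close>

definition perp_inner :: "real \<Rightarrow> real \<Rightarrow> real \<Rightarrow> real \<Rightarrow> real \<Rightarrow> real \<Rightarrow> real" where
  "perp_inner g a b a' b' h = h - (a * a' + b * b' - g * (a * b' + a' * b)) / (1 - g\<^sup>2)"

lemma perp_inner_eq:
  fixes x y x' y' e f :: "'a::real_inner"
  assumes "e \<bullet> e = 1" "f \<bullet> f = 1" "\<bar>e \<bullet> f\<bar> < 1"
    and "x' \<bullet> e = 0" "x' \<bullet> f = 0" "y' \<bullet> e = 0" "y' \<bullet> f = 0"
    and "x = x' + \<alpha> *\<^sub>R e + \<beta> *\<^sub>R f" "y = y' + \<gamma> *\<^sub>R e + \<delta> *\<^sub>R f"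
  shows "perp_inner (e \<bullet> f) (x \<bullet> e) (x \<bullet> f) (y \<bullet> e) (y \<bullet> f) (x \<bullet> y) = x' \<bullet> y'"
proof -
  define g where "g = e \<bullet> f"
  have g: "1 - g\<^sup>2 \<noteq> 0" 
    using assms(3) by (simp add: g_def abs_square_eq_1)
  have *: "x \<bullet> e = \<alpha> + \<beta> * g" "x \<bullet> f = \<alpha> * g + \<beta>" "y \<bullet> e = \<gamma> + \<delta> * g" "y \<bullet> f = \<gamma> * g + \<delta>"
    unfolding assms(8,9) using assms(1-7)
    by (simp_all add: g_def inner_add_left inner_commute[of f e])
  have "x \<bullet> y = x' \<bullet> y' + \<alpha> * \<gamma> + \<beta> * \<delta> + g * (\<alpha> * \<delta> + \<beta> * \<gamma>)"
    unfolding assms(8,9) using assms(1-7)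
    by (simp add: g_def inner_add_left inner_add_right inner_commute[of f e]
        inner_commute[of e y'] inner_commute[of f y'] algebra_simps)
  moreover have "(\<alpha> + \<beta> * g) * (\<gamma> + \<delta> * g) + (\<alpha> * g + \<beta>) * (\<gamma> * g + \<delta>) 
      - g * ((\<alpha> + \<beta> * g) * (\<gamma> * g + \<delta>) + (\<gamma> + \<delta> * g) * (\<alpha> * g + \<beta>))
     = (\<alpha> * \<gamma> + \<beta> * \<delta> + g * (\<alpha> * \<delta> + \<beta> * \<gamma>)) * (1 - g\<^sup>2)"
    by (simp add: algebra_simps power2_eq_square)
  ultimately show ?thesis
    unfolding perp_inner_def * g_def[symmetric] using g by simp
qed

text \<open>The plane spanned by \<open>v k\<close> and \<open>v m\<close> is the orthogonal complement of the span of \<open>w i\<close> and \<open>w j\<close>.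
  The component of \<open>w k\<close> in this plane is orthogonal to \<open>v m\<close>, which fixes its direction, and its
  length is fixed by \<open>w k \<bullet> v k\<close>.\<close>

lemma polar_decomposition:
  assumes "polar v w" and labels: "{i, j, k, m} = UNIV"
  defines "c \<equiv> v k \<bullet> v m"
  obtains \<alpha> \<beta> where
    "w k = (w k \<bullet> v k / (1 - c\<^sup>2)) *\<^sub>R (v k - c *\<^sub>R v m) + \<alpha> *\<^sub>R w i + \<beta> *\<^sub>R w j"
proof -
  have d: "distinct [i, j, k, m]" by (rule labels_distinct[OF labels])
  have c: "1 - c\<^sup>2 \<noteq> 0" 
    using polar_inner_less_1[OF assms(1), of k m] d by (auto simp: c_def abs_square_eq_1)
  define z where "z = w k - (w k \<bullet> v k / (1 - c\<^sup>2)) *\<^sub>R (v k - c *\<^sub>R v m)"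
  have "z \<bullet> v k = w k \<bullet> v k - (w k \<bullet> v k / (1 - c\<^sup>2)) * (1 - c\<^sup>2)"
    using polar_inner_self[OF assms(1)]
    by (simp add: z_def inner_diff_left c_def inner_commute[of "v m" "v k"] power2_eq_square)
  then have zk: "z \<bullet> v k = 0" using c by simp
  have zm: "z \<bullet> v m = 0"
    using polar_inner_self[OF assms(1)] assms(1) d
    by (simp add: z_def inner_diff_left c_def polar_def)
  have "z = (\<Sum>p\<in>{i, j, k, m}. (z \<bullet> v p / (w p \<bullet> v p)) *\<^sub>R w p)"
    unfolding labels by (rule polar_expansion[OF assms(1)])
  also have "\<dots> = (z \<bullet> v i / (w i \<bullet> v i)) *\<^sub>R w i + (z \<bullet> v j / (w j \<bullet> v j)) *\<^sub>R w j"
    using d zk zm by simp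
  finally have z: "z = (z \<bullet> v i / (w i \<bullet> v i)) *\<^sub>R w i + (z \<bullet> v j / (w j \<bullet> v j)) *\<^sub>R w j" .
  have "w k = (w k \<bullet> v k / (1 - c\<^sup>2)) *\<^sub>R (v k - c *\<^sub>R v m) + z"
    by (simp add: z_def)
  also have "\<dots> = (w k \<bullet> v k / (1 - c\<^sup>2)) *\<^sub>R (v k - c *\<^sub>R v m)
      + (z \<bullet> v i / (w i \<bullet> v i)) *\<^sub>R w i + (z \<bullet> v j / (w j \<bullet> v j)) *\<^sub>R w j"
    by (subst z) (simp only: add.assoc)
  finally show ?thesis by (rule that)
qed

text \<open>In the plane of \<open>v k\<close> and \<open>v m\<close>, the components of \<open>w k\<close> and \<open>w m\<close> are perpendicular to \<open>v m\<close> and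
  \<open>v k\<close> respectively, so the angle between them is the supplement of the angle between \<open>v k\<close> and
  \<open>v m\<close>. The last equation carries this: the cosine of the opposite edge can be read off from the
  normals.\<close>

lemma perp_inner_normals:
  assumes "polar v w" and labels: "{i, j, k, m} = UNIV"
  defines "c \<equiv> v k \<bullet> v m"
  defines "P \<equiv> \<lambda>p q. perp_inner (w i \<bullet> w j) (w p \<bullet> w i) (w p \<bullet> w j) (w q \<bullet> w i) (w q \<bullet> w j) (w p \<bullet> w q)"
  shows "P k k = (w k \<bullet> v k)\<^sup>2 / (1 - c\<^sup>2)"
    and "P m m = (w m \<bullet> v m)\<^sup>2 / (1 - c\<^sup>2)"
    and "P k m = - (c * (w k \<bullet> v k) * (w m \<bullet> v m) / (1 - c\<^sup>2))"
proof -
  have d: "distinct [i, j, k, m]" by (rule labels_distinct[OF labels])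
  have c: "1 - c\<^sup>2 \<noteq> 0" 
    using polar_inner_less_1[OF assms(1), of k m] d by (auto simp: c_def abs_square_eq_1)
  define a where "a = w k \<bullet> v k / (1 - c\<^sup>2)"
  define b where "b = w m \<bullet> v m / (1 - c\<^sup>2)"
  define x where "x = a *\<^sub>R (v k - c *\<^sub>R v m)"
  define y where "y = b *\<^sub>R (v m - c *\<^sub>R v k)"
  obtain \<alpha> \<beta> where k: "w k = x + \<alpha> *\<^sub>R w i + \<beta> *\<^sub>R w j"
    using polar_decomposition[OF assms(1) labels] unfolding x_def a_def c_def by blast
  have labels': "{i, j, m, k} = UNIV" using labels by auto
  obtain \<gamma> \<delta> where m: "w m = y + \<gamma> *\<^sub>R w i + \<delta> *\<^sub>R w j"
    using polar_decomposition[OF assms(1) labels'] unfolding y_def b_def c_def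
    by (metis inner_commute)
  have u: "w i \<bullet> w i = 1" "w j \<bullet> w j = 1" "\<bar>w i \<bullet> w j\<bar> < 1"
    using polar_inner_self[OF assms(1)] polar_inner_less_1[OF polar_sym[OF assms(1)], of i j] d
    by auto
  have o: "x \<bullet> w i = 0" "x \<bullet> w j = 0" "y \<bullet> w i = 0" "y \<bullet> w j = 0"
    using polar_sym[OF assms(1)] d unfolding x_def y_def
    by (auto simp: polar_def inner_diff_left)
  have "x \<bullet> x = a\<^sup>2 * (1 - c\<^sup>2)" "y \<bullet> y = b\<^sup>2 * (1 - c\<^sup>2)" "x \<bullet> y = - (a * b * c * (1 - c\<^sup>2))"
    using polar_inner_self[OF assms(1)]
    by (simp_all add: x_def y_def inner_diff_left inner_diff_right c_def[symmetric] 
        inner_commute[of "v m" "v k"] power2_eq_square algebra_simps)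
  then show "P k k = (w k \<bullet> v k)\<^sup>2 / (1 - c\<^sup>2)" "P m m = (w m \<bullet> v m)\<^sup>2 / (1 - c\<^sup>2)"
    "P k m = - (c * (w k \<bullet> v k) * (w m \<bullet> v m) / (1 - c\<^sup>2))"
    unfolding P_def perp_inner_eq[OF u o(1,2) o(1,2) k k] perp_inner_eq[OF u o(3,4) o(3,4) m m]
      perp_inner_eq[OF u o k m]
    using c by (simp_all add: a_def b_def power2_eq_square)
qed

section \<open>The Gram determinant\<close>

text \<open>Only the permutations that preserve \<open>{i, j}\<close> contribute to the Leibniz sum.\<close>

lemma det_block_triangular_4:
  fixes A :: "real^4^4"
  assumes labels: "{i, j, k, m} = UNIV"
    and zero: "A$i$k = 0" "A$i$m = 0" "A$j$k = 0" "A$j$m = 0"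
  shows "det A = (A$i$i * A$j$j - A$i$j * A$j$i) * (A$k$k * A$m$m - A$k$m * A$m$k)"
proof -
  have d: "distinct [i, j, k, m]" by (rule labels_distinct[OF labels])
  let ?ij = "Transposition.transpose i j" and ?km = "Transposition.transpose k m"
  let ?S = "{id, ?ij, ?km, ?ij \<circ> ?km}"
  let ?f = "\<lambda>p. of_int (sign p) * prod (\<lambda>r. A$r$p r) UNIV"
  have prod4: "prod h UNIV = h i * h j * h k * h m" for h :: "4 \<Rightarrow> real"
    unfolding labels[symmetric] using d by simp
  have cases: "r = i \<or> r = j \<or> r = k \<or> r = m" for r
    using labels by auto
  have "det A = sum ?f {p. p permutes UNIV}"
    by (simp add: det_def)
  also have "\<dots> = sum ?f ?S"
  proof (rule sum.mono_neutral_right)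
    show "finite {p. p permutes (UNIV :: 4 set)}" by simp
    show "?S \<subseteq> {p. p permutes UNIV}"
      by (auto intro: permutes_swap_id permutes_compose permutes_id)
    show "\<forall>p\<in>{p. p permutes UNIV} - ?S. ?f p = 0"
    proof (rule ballI, rule ccontr)
      fix p assume p: "p \<in> {p. p permutes UNIV} - ?S" and nz: "?f p \<noteq> 0"
      have inj: "inj p" using p by (auto dest: permutes_inj)
      have "p i \<noteq> k" "p i \<noteq> m" "p j \<noteq> k" "p j \<noteq> m"
        using nz zero by (auto simp: prod4)
      then have ij: "p i = i \<and> p j = j \<or> p i = j \<and> p j = i"
        using cases[of "p i"] cases[of "p j"] injD[OF inj, of i j] d by auto
      then have km: "p k = k \<and> p m = m \<or> p k = m \<and> p m = k"
        using cases[of "p k"] cases[of "p m"] injD[OF inj, of k m] injD[OF inj, of i k] 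
          injD[OF inj, of i m] injD[OF inj, of j k] injD[OF inj, of j m] d by auto
      have eq: "p = q" if "p i = q i" "p j = q j" "p k = q k" "p m = q m" for q
      proof
        show "p r = q r" for r using cases[of r] that by auto
      qed
      have "p = id" if "p i = i" "p j = j" "p k = k" "p m = m"
        using that by (intro eq) auto
      moreover have "p = ?ij" if "p i = j" "p j = i" "p k = k" "p m = m"
        using that d by (intro eq) auto
      moreover have "p = ?km" if "p i = i" "p j = j" "p k = m" "p m = k"
        using that d by (intro eq) auto
      moreover have "p = ?ij \<circ> ?km" if "p i = j" "p j = i" "p k = m" "p m = k"
        using that d by (intro eq) auto
      ultimately have "p \<in> ?S" using ij km by blast
      then show False using p by blast
    qed
  qed
  also have "\<dots> = ?f id + ?f ?ij + ?f ?km + ?f (?ij \<circ> ?km)"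
  proof -
    have at_i: "id i = i" "?ij i = j" "?km i = i" "(?ij \<circ> ?km) i = j"
      and at_k: "id k = k" "?ij k = k" "?km k = m" "(?ij \<circ> ?km) k = m"
      using d by auto
    have "id \<noteq> ?ij" "id \<noteq> ?ij \<circ> ?km" "?ij \<noteq> ?km" "?km \<noteq> ?ij \<circ> ?km"
      using at_i d by (auto dest: fun_cong[of _ _ i])
    moreover have "id \<noteq> ?km" "?ij \<noteq> ?ij \<circ> ?km"
      using at_k d by (auto dest: fun_cong[of _ _ k])
    ultimately show ?thesis by (simp add: add.assoc)
  qed
  also have "\<dots> = (A$i$i * A$j$j - A$i$j * A$j$i) * (A$k$k * A$m$m - A$k$m * A$m$k)"
  proof -
    have v: "?ij i = j" "?ij j = i" "?ij k = k" "?ij m = m"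
      "?km i = i" "?km j = j" "?km k = m" "?km m = k"
      using d by auto
    have "sign ?ij = -1" "sign ?km = -1" "sign (?ij \<circ> ?km) = 1"
      using d by (simp_all add: sign_compose permutation_swap_id sign_swap_id)
    then show ?thesis by (simp add: prod4 v algebra_simps)
  qed
  finally show ?thesis .
qed

text \<open>Multiplied by \<open>1 - (v i \<bullet> v j)\<^sup>2\<close>, both sides become \<open>(det V)\<^sup>2 (det M)\<^sup>2\<close>, where \<open>V\<close> has the
  vertices as rows and \<open>M\<close> has the rows \<open>v i\<close>, \<open>v j\<close>, \<open>w k\<close>, \<open>w m\<close>. Since \<open>v i\<close> and \<open>v j\<close> are
  orthogonal to \<open>w k\<close> and \<open>w m\<close>, the products of \<open>V\<close> and of \<open>M\<close> with the transpose of \<open>M\<close> are block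
  triangular. Geometrically, the volume spanned by the four vertices is the area spanned by \<open>v i\<close>
  and \<open>v j\<close> times an area in the plane of \<open>w k\<close> and \<open>w m\<close>.\<close>

lemma det_length_Gram:
  assumes "polar v w" and labels: "{i, j, k, m} = UNIV"
  shows "det (length_Gram v) * (1 - (w k \<bullet> w m)\<^sup>2)
     = (1 - (v i \<bullet> v j)\<^sup>2) * ((w k \<bullet> v k) * (w m \<bullet> v m))\<^sup>2"
proof -
  have d: "distinct [i, j, k, m]" by (rule labels_distinct[OF labels])
  then have d': "j \<noteq> i" "k \<noteq> i" "k \<noteq> j" "m \<noteq> i" "m \<noteq> j" "m \<noteq> k" by auto
  define V :: "real^4^4" where "V = (\<chi> p. v p)"
  define M :: "real^4^4" where "M = (\<chi> p. if p = i \<or> p = j then v p else w p)"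
  define A where "A = 1 - (v i \<bullet> v j)\<^sup>2"
  define B where "B = 1 - (w k \<bullet> w m)\<^sup>2"
  define x where "x = (w k \<bullet> v k) * (w m \<bullet> v m)"
  have entry: "(X ** transpose Y) $ p $ q = X $ p \<bullet> Y $ q" for X Y :: "real^4^4" and p q
    by (simp add: matrix_matrix_mult_def transpose_def inner_vec_def)
  have vv: "v p \<bullet> v p = 1" "w p \<bullet> w p = 1" for p using polar_inner_self[OF assms(1)] by auto
  have ortho: "w p \<bullet> v q = 0" "v q \<bullet> w p = 0" if "p \<noteq> q" for p q
    using assms(1) that by (auto simp: polar_def inner_commute)
  have "length_Gram v = V ** transpose V"
    by (simp add: vec_eq_iff entry length_Gram_def V_def cos_edge_length[OF assms(1)])
  then have VV: "det (length_Gram v) = (det V)\<^sup>2"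
    by (simp add: det_mul power2_eq_square)
  have "det V * det M = det (V ** transpose M)"
    by (simp add: det_mul)
  also have "\<dots> = A * x"
    using d d' ortho vv
    by (subst det_block_triangular_4[OF labels])
       (simp_all add: entry V_def M_def A_def x_def power2_eq_square inner_commute[of "v j" "v i"]
         inner_commute[of "v k" "w k"] inner_commute[of "v m" "w m"])
  finally have VM: "det V * det M = A * x" .
  have "(det M)\<^sup>2 = det (M ** transpose M)"
    by (simp add: det_mul power2_eq_square)
  also have "\<dots> = A * B"
    using d d' ortho vv
    by (subst det_block_triangular_4[OF labels])
       (simp_all add: entry M_def A_def B_def power2_eq_square inner_commute[of "v j" "v i"]
         inner_commute[of "w m" "w k"])
  finally have MM: "(det M)\<^sup>2 = A * B" .
  have "A \<noteq> 0"
    using polar_inner_less_1[OF assms(1), of i j] d by (auto simp: A_def abs_square_eq_1)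
  moreover have "A * (det (length_Gram v) * B) = A * (A * x\<^sup>2)"
    using VV VM MM by (metis (no_types, lifting) mult.left_commute mult.commute power2_eq_square power_mult_distrib)
  ultimately show ?thesis by (simp add: A_def B_def x_def)
qed

section \<open>The opposite edge as a function of the dihedral angles\<close>

text \<open>The faces opposite \<open>p\<close> and \<open>q\<close> meet along the edge joining the other two vertices, hence the
  complement.\<close>

definition normal_Gram :: "(4 set \<Rightarrow> real) \<Rightarrow> 4 \<Rightarrow> 4 \<Rightarrow> real" where
  "normal_Gram \<Theta> p q = (if p = q then 1 else - cos (\<Theta> (- {p, q})))"

text \<open>The Gram matrix of the normals after projection to the orthogonal complement of \<open>w i\<close> and \<open>w j\<close>,
  as a function of the dihedral angles.\<close>

definition projected_normal_Gram :: "(4 set \<Rightarrow> real) \<Rightarrow> 4 \<Rightarrow> 4 \<Rightarrow> 4 \<Rightarrow> 4 \<Rightarrow> real" where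
  "projected_normal_Gram \<Theta> i j p q =
     perp_inner (normal_Gram \<Theta> i j) (normal_Gram \<Theta> p i) (normal_Gram \<Theta> p j)
       (normal_Gram \<Theta> q i) (normal_Gram \<Theta> q j) (normal_Gram \<Theta> p q)"

lemma card_Compl_pair:
  fixes e :: "4 set" assumes "card e = 2" shows "card (- e) = 2"
  using assms by (simp add: Compl_eq_Diff_UNIV card_Diff_subset)

lemma normal_Gram_eq_inner:
  assumes "polar v w" and "\<And>e. card e = 2 \<Longrightarrow> dihedral_angle v e = \<Theta> e"
  shows "normal_Gram \<Theta> p q = w p \<bullet> w q"
proof (cases "p = q")
  case True
  then show ?thesis using polar_inner_self[OF assms(1)] by (simp add: normal_Gram_def)
next
  case False
  then have "card (- {p, q}) = 2" by (intro card_Compl_pair) simp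
  then show ?thesis
    using dihedral_angle(3)[OF assms(1) _ False, of "- {p, q}"] assms(2)[of "- {p, q}"] False
    by (simp add: normal_Gram_def)
qed

lemma projected_normal_Gram_polar:
  assumes "polar v w" and "{i, j, k, m} = UNIV"
    and "\<And>e. card e = 2 \<Longrightarrow> dihedral_angle v e = \<Theta> e"
  defines "c \<equiv> v k \<bullet> v m"
  shows "sqrt (projected_normal_Gram \<Theta> i j k k * projected_normal_Gram \<Theta> i j m m)
           = (w k \<bullet> v k) * (w m \<bullet> v m) / (1 - c\<^sup>2)"
    and "projected_normal_Gram \<Theta> i j k m = - (c * (w k \<bullet> v k) * (w m \<bullet> v m) / (1 - c\<^sup>2))"
proof -
  have d: "distinct [i, j, k, m]" by (rule labels_distinct[OF assms(2)])
  have c: "1 - c\<^sup>2 > 0"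
    using polar_inner_less_1[OF assms(1), of k m] d by (auto simp: c_def abs_square_less_1)
  have neg: "w k \<bullet> v k < 0" "w m \<bullet> v m < 0"
    using assms(1) by (auto simp: polar_def)
  have G: "normal_Gram \<Theta> p q = w p \<bullet> w q" for p q
    by (rule normal_Gram_eq_inner[OF assms(1,3)])
  note P = perp_inner_normals[OF assms(1,2), folded c_def]
  have "projected_normal_Gram \<Theta> i j k k * projected_normal_Gram \<Theta> i j m m
      = ((w k \<bullet> v k) * (w m \<bullet> v m) / (1 - c\<^sup>2))\<^sup>2"
    unfolding projected_normal_Gram_def G P by (simp add: power2_eq_square)
  moreover have "(w k \<bullet> v k) * (w m \<bullet> v m) / (1 - c\<^sup>2) \<ge> 0"
    using c neg by (simp add: mult_neg_neg less_imp_le)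
  ultimately show "sqrt (projected_normal_Gram \<Theta> i j k k * projected_normal_Gram \<Theta> i j m m)
           = (w k \<bullet> v k) * (w m \<bullet> v m) / (1 - c\<^sup>2)"
    by (simp only: real_sqrt_abs abs_of_nonneg)
  show "projected_normal_Gram \<Theta> i j k m = - (c * (w k \<bullet> v k) * (w m \<bullet> v m) / (1 - c\<^sup>2))"
    unfolding projected_normal_Gram_def G P ..
qed

text \<open>Since the right-hand side mentions the angles only, any two tetrahedra with the same dihedral
  angles have the same opposite edge; this is what makes \<open>length_of_angles\<close> well defined.\<close>

lemma edge_length_from_angles:
  assumes "spherical_tetrahedron v" and labels: "{i, j, k, m} = UNIV"
    and angles: "\<And>e. card e = 2 \<Longrightarrow> dihedral_angle v e = \<Theta> e"
  shows "edge_length v k m = arccos (- projected_normal_Gram \<Theta> i j k m /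
     sqrt (projected_normal_Gram \<Theta> i j k k * projected_normal_Gram \<Theta> i j m m))"
proof -
  obtain w where w: "polar v w"
    using spherical_tetrahedron_imp_polar[OF assms(1)] by blast
  have "(1 - (v k \<bullet> v m)\<^sup>2) \<noteq> 0"
    using polar_inner_less_1[OF w, of k m] labels_distinct[OF labels] by (auto simp: abs_square_eq_1)
  moreover have "w k \<bullet> v k \<noteq> 0" "w m \<bullet> v m \<noteq> 0"
    using w by (metis less_irrefl polar_def)+
  ultimately show ?thesis
    by (simp add: edge_length_def projected_normal_Gram_polar[OF w labels angles])
qed

lemma length_of_angles_eq:
  assumes "spherical_tetrahedron u" and "{i, j, k, m} = UNIV"
    and "\<And>e. card e = 2 \<Longrightarrow> dihedral_angle u e = \<Theta> e"
  shows "length_of_angles \<Theta> k m = arccos (- projected_normal_Gram \<Theta> i j k m /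
     sqrt (projected_normal_Gram \<Theta> i j k k * projected_normal_Gram \<Theta> i j m m))"
  unfolding length_of_angles_def
proof (rule the_equality, goal_cases)
  case 1
  show ?case using assms edge_length_from_angles[OF assms] by metis
next
  case (2 l)
  then show ?case using edge_length_from_angles[OF _ assms(2)] by metis
qed

section \<open>Tetrahedra with one dihedral angle varied\<close>

text \<open>The vector \<open>x\<close>, orthogonal to the members that are kept, certifies that the new one is not in
  their span.\<close>

lemma spherical_tetrahedron_fun_upd:
  assumes "spherical_tetrahedron w" and "norm y = 1" "y \<bullet> x \<noteq> 0" "\<And>p. p \<noteq> m \<Longrightarrow> w p \<bullet> x = 0"
  shows "spherical_tetrahedron (w(m := y))"
proof -
  have w: "inj w" "independent (range w)" "\<And>p. norm (w p) = 1"
    using assms(1) by (auto simp: spherical_tetrahedron_def)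
  have ne: "w p \<noteq> y" if "p \<noteq> m" for p
    using assms(3,4) that by metis
  have "inj (w(m := y))"
    using w(1) ne by (auto simp: inj_def split: if_splits)
  moreover have "y \<notin> span (w ` (- {m}))"
  proof
    assume "y \<in> span (w ` (- {m}))"
    then have "orthogonal x y"
      by (rule orthogonal_to_span) (use assms(4) in \<open>auto simp: orthogonal_def inner_commute[of x]\<close>)
    then show False using assms(3) by (simp add: orthogonal_def inner_commute)
  qed
  then have "independent (insert y (w ` (- {m})))"
    using independent_mono[OF w(2), of "w ` (- {m})"] by (simp add: independent_insertI image_mono)
  moreover have "range (w(m := y)) = insert y (w ` (- {m}))"
    by (auto simp: image_iff)
  ultimately show ?thesis
    using w(3) assms(2) by (simp add: spherical_tetrahedron_def)
qed

text \<open>A tetrahedron whose angle at the edge \<open>{i, j}\<close> is changed to a nearby value \<open>t\<close>, the other five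
  being kept, is obtained by replacing the single normal \<open>w m\<close>. The new normal must have the old
  inner products with \<open>w i\<close> and \<open>w j\<close>, the inner product \<open>- cos t\<close> with \<open>w k\<close>, and length 1. The
  vector \<open>q\<close> is orthogonal to \<open>w i\<close>, \<open>w j\<close> and \<open>v m\<close>, so adding a multiple of it adjusts only the
  product with \<open>w k\<close>; the vector \<open>v m\<close> is orthogonal to \<open>w i\<close>, \<open>w j\<close> and \<open>w k\<close>, so a multiple of it
  restores the length. This is possible as long as the part orthogonal to \<open>v m\<close> is shorter than 1,
  which is an open condition that holds at the given tetrahedron. A family of normals is itself a
  spherical tetrahedron, whose own outward normals are the vertices sought.\<close>

lemma eventually_exists_tetrahedron_with_angles:
  assumes "polar v w" and labels: "{i, j, k, m} = UNIV"
  shows "\<forall>\<^sub>F t in nhds (dihedral_angle v {i, j}). \<exists>u. spherical_tetrahedron u \<and>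
     (\<forall>e. card e = 2 \<longrightarrow> dihedral_angle u e = ((dihedral_angle v)({i, j} := t)) e)"
proof -
  have d: "distinct [i, j, k, m]" by (rule labels_distinct[OF labels])
  have compl: "- {i, j} = {k, m}" using labels d by auto
  define \<theta> where "\<theta> = dihedral_angle v {i, j}"
  have \<theta>: "0 < \<theta>" "\<theta> < pi" "cos \<theta> = - (w k \<bullet> w m)"
    using dihedral_angle[OF assms(1) compl] d by (auto simp: \<theta>_def)
  note vv = polar_inner_self[OF assms(1)]
  have ortho: "w p \<bullet> v q = 0" if "p \<noteq> q" for p q
    using assms(1) that by (auto simp: polar_def)
  have neg: "w p \<bullet> v p < 0" for p
    using assms(1) by (auto simp: polar_def)
  define q where "q = v k - (v k \<bullet> v m) *\<^sub>R v m"
  define b where "b t = w m - (w m \<bullet> v m) *\<^sub>R v m + ((- cos t - w k \<bullet> w m) / (w k \<bullet> v k)) *\<^sub>R q" for t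
  have b_v: "b t \<bullet> v m = 0" for t
    using vv by (simp add: b_def q_def inner_add_left inner_diff_left)
  have b_w: "w p \<bullet> b t = w p \<bullet> w m" if "p = i \<or> p = j" for p t
    using that ortho d by (auto simp: b_def q_def inner_add_right inner_diff_right)
  have b_wk: "w k \<bullet> b t = - cos t" for t
    using ortho[of k m] d neg[of k]
    by (simp add: b_def q_def inner_add_right inner_diff_right)
  have "isCont (\<lambda>t. b t \<bullet> b t) \<theta>"
    unfolding b_def using neg[of k] by (intro continuous_intros) auto
  then have "((\<lambda>t. b t \<bullet> b t) \<longlongrightarrow> b \<theta> \<bullet> b \<theta>) (nhds \<theta>)"
    unfolding isCont_def by (rule tendsto_at_iff_tendsto_nhds[THEN iffD1])
  moreover have "b \<theta> \<bullet> b \<theta> < 1"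
  proof -
    have "b \<theta> \<bullet> b \<theta> = 1 - (w m \<bullet> v m)\<^sup>2"
      using vv by (simp add: b_def \<theta>(3) inner_diff_left inner_diff_right power2_eq_square 
          inner_commute[of "v m" "w m"])
    then show ?thesis using neg[of m] by simp
  qed
  ultimately have "\<forall>\<^sub>F t in nhds \<theta>. b t \<bullet> b t < 1"
    by (rule order_tendstoD(2))
  moreover have "\<forall>\<^sub>F t in nhds \<theta>. t \<in> {0<..<pi}"
    using \<theta> by (intro eventually_nhds_in_open) auto
  ultimately show ?thesis
    unfolding \<theta>_def[symmetric]
  proof eventually_elim
    case (elim t)
    define y where "y = b t - sqrt (1 - b t \<bullet> b t) *\<^sub>R v m"
    define w' where "w' = w(m := y)"
    have "y \<bullet> y = 1"
      using elim(1) b_v vv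
      by (simp add: y_def inner_diff_left inner_diff_right inner_commute[of "v m" "b t"])
    then have "norm y = 1" by (simp add: norm_eq_1)
    moreover have "y \<bullet> v m \<noteq> 0"
      using elim(1) b_v vv by (simp add: y_def inner_diff_left)
    ultimately have "spherical_tetrahedron w'"
      unfolding w'_def
      using spherical_tetrahedron_fun_upd polar_imp_spherical_tetrahedron[OF polar_sym[OF assms(1)]] ortho
      by metis
    then obtain u where "polar w' u"
      using spherical_tetrahedron_imp_polar by blast
    then have u: "polar u w'" by (rule polar_sym)
    have w'_wm: "w' p \<bullet> w' m = w p \<bullet> w m" if "p = i \<or> p = j" for p
      using that d b_w[OF that] ortho by (auto simp: w'_def y_def inner_diff_right)
    have "dihedral_angle u e = ((dihedral_angle v)({i, j} := t)) e" if e: "card e = 2" for e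
    proof (cases "e = {i, j}")
      case True
      have "w' k \<bullet> w' m = - cos t"
        using d b_wk ortho by (simp add: w'_def y_def inner_diff_right)
      then show ?thesis
        using dihedral_angle_eqI[OF u compl, of t] elim(2) True by simp
    next
      case False
      obtain p r where pr: "- e = {p, r}" "p \<noteq> r"
        using card_Compl_pair[OF e] by (auto simp: card_2_iff)
      have nkm: "{p, r} \<noteq> {k, m}"
        using False pr(1) compl by (metis double_complement)
      have cases: "x = i \<or> x = j \<or> x = k \<or> x = m" for x
        using labels by auto
      have "w' p \<bullet> w' r = w p \<bullet> w r"
      proof -
        consider "p \<noteq> m" "r \<noteq> m" | "r = m" "p = i \<or> p = j" | "p = m" "r = i \<or> r = j"
          using cases[of p] cases[of r] pr(2) nkm by (auto simp: insert_commute)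
        then show ?thesis
        proof cases
          case 1 then show ?thesis by (simp add: w'_def)
        next
          case 2 then show ?thesis using w'_wm by simp
        next
          case 3 then show ?thesis
            using w'_wm[of r] by (simp add: inner_commute[of "w' m"] inner_commute[of "w m"])
        qed
      qed
      then have "dihedral_angle u e = dihedral_angle v e"
        using dihedral_angle[OF assms(1) pr] by (intro dihedral_angle_eqI[OF u pr(1)]) auto
      then show ?thesis using False by simp
    qed
    then show ?case using polar_imp_spherical_tetrahedron[OF u] by blast
  qed
qed

section \<open>The derivative\<close>

theorem theorem1p2:
  fixes v :: "4 \<Rightarrow> real^4" and i j k m :: 4
  assumes "spherical_tetrahedron v"
    and "{i, j, k, m} = UNIV"
  shows "((\<lambda>t. length_of_angles ((dihedral_angle v)({i, j} := t)) k m) has_real_derivative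
           sin (edge_length v i j) * sin (edge_length v k m) / sqrt (det (length_Gram v)))
         (at (dihedral_angle v {i, j}))"
proof -
  obtain w where w: "polar v w"
    using spherical_tetrahedron_imp_polar[OF assms(1)] by blast
  have d: "distinct [i, j, k, m]" by (rule labels_distinct[OF assms(2)])
  have compl: "- {i, j} = {k, m}" using assms(2) d by auto
  have compl': "- {k, m} = {i, j}" using compl by blast
  define \<theta> where "\<theta> = dihedral_angle v {i, j}"
  have \<theta>: "0 < \<theta>" "\<theta> < pi" "cos \<theta> = - (w k \<bullet> w m)"
    using dihedral_angle[OF w compl] d by (auto simp: \<theta>_def)
  have sin_\<theta>: "sin \<theta> > 0" "(sin \<theta>)\<^sup>2 = 1 - (w k \<bullet> w m)\<^sup>2"
    using \<theta> by (auto simp: sin_gt_zero sin_squared_eq)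
  define l l' where "l = edge_length v i j" and "l' = edge_length v k m"
  have l: "sin l > 0" "(sin l)\<^sup>2 = 1 - (v i \<bullet> v j)\<^sup>2"
    and l': "sin l' > 0" "(sin l')\<^sup>2 = 1 - (v k \<bullet> v m)\<^sup>2"
    using sin_edge_length[OF w] d by (auto simp: l_def l'_def)
  define x where "x = (w k \<bullet> v k) * (w m \<bullet> v m)"
  have x: "x > 0" using w by (simp add: x_def polar_def mult_neg_neg)
  define P where "P = projected_normal_Gram (dihedral_angle v) i j"
  define R where "R = sqrt (P k k * P m m)"
  \<comment> \<open>The angle \<open>\<theta>\<close> enters the projected Gram matrix only through the summand \<open>- cos \<theta>\<close> of its
    entry at \<open>k\<close> and \<open>m\<close>; what remains of this entry is \<open>K\<close>.\<close>
  define K where "K = P k m + cos \<theta>"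
  have R: "R = x / (sin l')\<^sup>2" and Pkm: "P k m = - (v k \<bullet> v m) * R"
    using projected_normal_Gram_polar[OF w assms(2), of "dihedral_angle v"]
    by (simp_all add: P_def R_def l'(2) x_def)
  have R0: "R > 0" using x l'(1) by (simp add: R)
  have eq_arccos: "\<forall>\<^sub>F t in nhds \<theta>. length_of_angles ((dihedral_angle v)({i, j} := t)) k m 
      = arccos ((cos t - K) / R)"
    using eventually_exists_tetrahedron_with_angles[OF w assms(2), folded \<theta>_def]
  proof eventually_elim
    case (elim t)
    let ?\<Theta> = "(dihedral_angle v)({i, j} := t)"
    have upd: "normal_Gram ?\<Theta> p q = normal_Gram (dihedral_angle v) p q" if "{p, q} \<noteq> {k, m}" for p q
      using that compl' by (auto simp: normal_Gram_def)
    have diag: "normal_Gram \<Phi> p p = 1" for \<Phi> p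
      by (simp add: normal_Gram_def)
    have G: "normal_Gram ?\<Theta> k m = - cos t" "normal_Gram (dihedral_angle v) k m = - cos \<theta>"
      using d by (auto simp: normal_Gram_def compl' \<theta>_def)
    have "projected_normal_Gram ?\<Theta> i j k k = P k k" "projected_normal_Gram ?\<Theta> i j m m = P m m"
      using d by (simp_all add: projected_normal_Gram_def P_def diag upd doubleton_eq_iff)
    moreover have "projected_normal_Gram ?\<Theta> i j k m = K - cos t"
      using d by (simp add: projected_normal_Gram_def P_def K_def upd doubleton_eq_iff G perp_inner_def)
    moreover obtain u where "spherical_tetrahedron u" "\<And>e. card e = 2 \<Longrightarrow> dihedral_angle u e = ?\<Theta> e"
      using elim by blast
    ultimately show ?case
      using length_of_angles_eq[OF _ assms(2), of u ?\<Theta>] by (simp add: R_def)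
  qed
  have at_\<theta>: "(cos \<theta> - K) / R = v k \<bullet> v m"
    using R0 by (simp add: K_def Pkm)
  have c: "\<bar>v k \<bullet> v m\<bar> < 1"
    using polar_inner_less_1[OF w, of k m] d by auto
  have "((\<lambda>t. arccos ((cos t - K) / R)) has_real_derivative
      inverse (- sqrt (1 - ((cos \<theta> - K) / R)\<^sup>2)) * (- sin \<theta> / R)) (at \<theta>)"
    using c R0 by (intro DERIV_chain2[OF DERIV_arccos]) 
      (auto simp: at_\<theta> abs_less_iff intro!: derivative_eq_intros)
  moreover have "inverse (- sqrt (1 - ((cos \<theta> - K) / R)\<^sup>2)) * (- sin \<theta> / R)
      = sin l * sin l' / sqrt (det (length_Gram v))"
  proof -
    have G: "det (length_Gram v) * (sin \<theta>)\<^sup>2 = (sin l * x)\<^sup>2"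
      using det_length_Gram[OF w assms(2)] by (simp add: sin_\<theta>(2) l(2) x_def power_mult_distrib)
    then have "sqrt (det (length_Gram v)) * sin \<theta> = sin l * x"
      using real_sqrt_mult[of "det (length_Gram v)" "(sin \<theta>)\<^sup>2"] sin_\<theta>(1) l(1) x by simp
    then have S: "sqrt (det (length_Gram v)) = sin l * x / sin \<theta>"
      using sin_\<theta>(1) by (simp add: field_simps)
    have S': "sqrt (1 - ((cos \<theta> - K) / R)\<^sup>2) = sin l'"
      using l' by (simp add: at_\<theta> flip: l'(2))
    show ?thesis
      unfolding S S' unfolding R using l(1) l'(1) x sin_\<theta>(1) by (simp add: field_simps power2_eq_square)
  qed
  ultimately show ?thesis
    using DERIV_cong_ev[OF refl eq_arccos refl] by (simp add: \<theta>_def l_def l'_def)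
qed

end
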